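(* Let $G$ be a $\nabla$-hyperflower with $M$ edges, and let $\omega$ be a $\nabla$-th root of $1$. Then $\sqrt[\nabla]{M^{\nabla-1}},\ \omega\sqrt[\nabla]{M^{\nabla-1}},\ \ldots,\ \omega^{\nabla-1}\sqrt[\nabla]{M^{\nabla-1}}$ are eigenvalues of the adjacency tensor $A(G)$. If, furthermore, $M=n(\nabla-1)+1$ for some positive integer $n$, then $1,\omega,\ldots,\omega^{\nabla-1}$ are also eigenvalues of $A(G)$.
   Context: For $N\ge\nabla\ge2$, the $\nabla$-hyperflower on $N$ nodes is the unweighted hypergraph with vertex set $\{v_1,\ldots,v_N\}$ and the $M=N-\nabla+1$ edges $\ell_j=\{v_1,\ldots,v_{\nabla-1},v_j\}$, $j=\nabla,\dots,N$. Its adjacency tensor $A$ is the $\nabla$-th order $N$-dimensional tensor with $A_{i_1,\ldots,i_\nabla}=1/(\nabla-1)!$ if $\{v_{i_1},\ldots,v_{i_\nabla}\}$ is an edge and $0$ otherwise. For a $k$-th order $n$-dimensional tensor $T$, $\lambda\in\mathbb{C}$ is an eigenvalue if there is $\mathbf{x}\in\mathbb{C}^n\setminus\{0\}$ with $\sum_{i_2,\ldots,i_k}T_{i,i_2,\ldots,i_k}x_{i_2}\cdots x_{i_k}=\lambda x_i^{k-1}$ for all $i$. $\sqrt[\nabla]{M^{\nabla-1}}$ denotes the positive real root.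
   Formalization: The second claim (that 1, ω, …, ω^{∇−1} are eigenvalues when M = n(∇−1)+1) is stated only for ∇ ≥ 3; for ∇ = 2 it is always false, since the star with M = n+1 ≥ 2 edges has only the eigenvalues 0 and ±√M. *)

theory Defs
  imports Complex_Main
begin

record 'v hypergraph =
  verts :: "'v set"
  edges :: "'v set set"

text \<open>The uniformity \<open>k\<close> is the parameter written nabla in the source; \<open>v\<close> is the labelling
  \<open>v\<^sub>1, \<dots>, v\<^sub>N\<close> of the nodes (only its values on \<open>{1..N}\<close> are relevant).\<close>

definition hyperflower :: "nat \<Rightarrow> nat \<Rightarrow> (nat \<Rightarrow> 'v) \<Rightarrow> 'v hypergraph \<Rightarrow> bool" where
  "hyperflower k N v G \<longleftrightarrow>
     2 \<le> k \<and> k \<le> N \<and> inj_on v {1..N} \<and>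
     verts G = v ` {1..N} \<and>
     edges G = (\<lambda>j. v ` {1..k-1} \<union> {v j}) ` {k..N}"

text \<open>A \<open>k\<close>-th order \<open>N\<close>-dimensional tensor is a function on index lists, of which only
  the values on the lists of length \<open>k\<close> with entries in \<open>{1..N}\<close> are relevant.\<close>

type_synonym tensor = "nat list \<Rightarrow> complex"

definition index_lists :: "nat \<Rightarrow> nat \<Rightarrow> nat list set" where
  "index_lists m N = {js. length js = m \<and> set js \<subseteq> {1..N}}"

definition adjacency_tensor :: "nat \<Rightarrow> (nat \<Rightarrow> 'v) \<Rightarrow> 'v hypergraph \<Rightarrow> tensor" where
  "adjacency_tensor k v G is = (if v ` set is \<in> edges G then 1 / fact (k - 1) else 0)"

definition tensor_eigenvalue :: "nat \<Rightarrow> nat \<Rightarrow> tensor \<Rightarrow> complex \<Rightarrow> bool" where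
  "tensor_eigenvalue k N T \<mu> \<longleftrightarrow>
     (\<exists>x :: nat \<Rightarrow> complex.
        (\<exists>i\<in>{1..N}. x i \<noteq> 0) \<and>
        (\<forall>i\<in>{1..N}. (\<Sum>js\<in>index_lists (k - 1) N. T (i # js) * (\<Prod>j\<leftarrow>js. x j)) = \<mu> * x i ^ (k - 1)))"

lemma card_edges_hyperflower:
  assumes "hyperflower k N v G"
  shows "card (edges G) = N - k + 1"
proof -
  have k: "2 \<le> k" "k \<le> N" and v: "inj_on v {1..N}"
    and E: "edges G = (\<lambda>j. v ` {1..k-1} \<union> {v j}) ` {k..N}"
    using assms by (auto simp: hyperflower_def)
  have notin: "v j \<notin> v ` {1..k-1}" if "j \<in> {k..N}" for j
    using that k inj_onD[OF v, of j] by fastforce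
  have "inj_on (\<lambda>j. v ` {1..k-1} \<union> {v j}) {k..N}"
  proof (rule inj_onI)
    fix i j assume ij: "i \<in> {k..N}" "j \<in> {k..N}"
      and eq: "v ` {1..k-1} \<union> {v i} = v ` {1..k-1} \<union> {v j}"
    have "v i = v j" using eq notin[OF ij(1)] by blast
    then show "i = j" using ij k inj_onD[OF v, of i j] by auto
  qed
  then show ?thesis using E k by (simp add: card_image)
qed

text \<open>The 2-hyperflowers are the stars. With two edges (\<open>M = 1 \<cdot> (k - 1) + 1\<close>) the number 1 is
  not an eigenvalue, so the claim about roots of unity requires \<open>k \<ge> 3\<close>.\<close>

lemma not_eigenvalue_two_edge_star:
  assumes "hyperflower 2 3 v G"
  shows "\<not> tensor_eigenvalue 2 3 (adjacency_tensor 2 v G) 1"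
proof
  have v: "inj_on v {1..3}" and E: "edges G = {{v 1, v 2}, {v 1, v 3}}"
    using assms by (auto simp: hyperflower_def numeral_2_eq_2 numeral_3_eq_3 atLeastAtMostSuc_conv)
  have d: "v 1 \<noteq> v 2" "v 1 \<noteq> v 3" "v 2 \<noteq> v 3"
    using inj_onD[OF v, of 1 2] inj_onD[OF v, of 1 3] inj_onD[OF v, of 2 3] by auto
  have L: "index_lists 1 3 = {[1], [2], [3]}"
    by (auto simp: index_lists_def length_Suc_conv)
  assume "tensor_eigenvalue 2 3 (adjacency_tensor 2 v G) 1"
  then obtain x where nz: "\<exists>i\<in>{1..3}. x i \<noteq> 0" and
    x: "\<forall>i\<in>{1..3}. (\<Sum>js\<in>index_lists 1 3.
          adjacency_tensor 2 v G (i # js) * (\<Prod>j\<leftarrow>js. x j)) = x i"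
    unfolding tensor_eigenvalue_def by auto
  have "x 2 + x 3 = x 1" "x 1 = x 2" "x 1 = x 3"
    using x[rule_format, of 1] x[rule_format, of 2] x[rule_format, of 3] d
    unfolding L by (auto simp: adjacency_tensor_def E doubleton_eq_iff)
  then have "x 1 = 0" "x 2 = 0" "x 3 = 0" by auto
  moreover have "{1..3} = {1, 2, 3 :: nat}" by auto
  ultimately show False using nz by auto
qed

end

(* On the vector that is constantly a (nonzero) on the core v_1, ..., v_(k-1) and arbitrary
   on the leaves, the eigenvalue equations reduce to: the leaf values sum to lambda * a, and
   each leaf value y satisfies a^(k-1) = lambda * y^(k-1). If lambda^k = M^(k-1), take y = 1 on
   every leaf and a = M / lambda. If lambda^k = 1 and M = n(k-1)+1 with k >= 3, let the leaf values
   be the first M powers of a (k-1)-th root of unity other than 1: each full period sums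
   to 0 and one further 1 is left over, so they sum to 1 and a = 1 / lambda works. *)
theory Submission
  imports Defs "HOL-Combinatorics.Multiset_Permutations"
begin

text \<open>With only \<open>m\<close> entries available to supply the remaining \<open>m\<close>
  elements of \<open>B\<close>, a list has no room for a repetition or for \<open>i\<close>
  itself.\<close>

lemma lists_completing_set:
  assumes "i \<in> B" "finite B" "card B = Suc m"
  shows "{js. length js = m \<and> insert i (set js) = B} = permutations_of_set (B - {i})"
proof (intro set_eqI iffI)
  fix js assume "js \<in> {js. length js = m \<and> insert i (set js) = B}"
  then have len: "length js = m" and B: "insert i (set js) = B" by auto
  have "i \<notin> set js"
  proof
    assume "i \<in> set js"
    then have "B = set js" using B by auto
    then show False using card_length[of js] len assms(3) by simp
  qed
  then have "set js = B - {i}" using B by auto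
  moreover have "card (B - {i}) = m" using assms by simp
  ultimately show "js \<in> permutations_of_set (B - {i})"
    using len by (simp add: permutations_of_set_def card_distinct)
next
  fix js assume js: "js \<in> permutations_of_set (B - {i})"
  then have "length js = m"
    using assms by (metis card_Diff_singleton diff_Suc_1 distinct_card permutations_of_setD)
  moreover have "insert i (set js) = B"
    using js assms(1) by (auto dest: permutations_of_setD)
  ultimately show "js \<in> {js. length js = m \<and> insert i (set js) = B}" by simp
qed

text \<open>An edge through \<open>i\<close> is hit by exactly (k-1)! index lists, the orderings of
  its other vertices. All of them give the same product, so the count cancels the weight 1/(k-1)!.
  The edges enter through their index sets \<open>F\<close>, so that everything after this happens
  inside {1..N}.\<close>

lemma adjacency_tensor_apply:
  fixes x :: "nat \<Rightarrow> complex"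
  assumes v: "inj_on v {1..N}" and k: "k > 0"
    and E: "edges G = (image v) ` F"
    and F: "\<And>B. B \<in> F \<Longrightarrow> B \<subseteq> {1..N} \<and> card B = k"
    and i: "i \<in> {1..N}"
  shows "(\<Sum>js\<in>index_lists (k - 1) N. adjacency_tensor k v G (i # js) * (\<Prod>j\<leftarrow>js. x j))
       = (\<Sum>B\<in>{B\<in>F. i \<in> B}. \<Prod>j\<in>B - {i}. x j)"
proof -
  let ?L = "index_lists (k - 1) N"
  let ?Fi = "{B\<in>F. i \<in> B}"
  let ?P = "\<lambda>B. permutations_of_set (B - {i})"
  have finL: "finite ?L"
    unfolding index_lists_def using finite_lists_length_eq[of "{1..N}" "k - 1"]
    by (simp add: conj_commute)
  have finB: "finite B" if "B \<in> F" for B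
    using F[OF that] finite_subset by blast
  have finF: "finite ?Fi"
    by (rule finite_subset[of _ "Pow {1..N}"]) (use F in auto)
  have P: "?P B = {js. length js = k - 1 \<and> insert i (set js) = B}" if "B \<in> ?Fi" for B
    using lists_completing_set[of i B "k - 1"] that F[of B] finB[of B] k by auto
  \<comment> \<open>The labelling is injective only on {1..N}, so both index sets must lie there
    before their images can be compared.\<close>
  have edge: "v ` set (i # js) \<in> edges G \<longleftrightarrow> insert i (set js) \<in> F" if "js \<in> ?L" for js
  proof -
    have "set (i # js) \<subseteq> {1..N}" using that i by (auto simp: index_lists_def)
    then have "v ` set (i # js) = v ` B \<longleftrightarrow> set (i # js) = B" if "B \<in> F" for B
      using inj_on_image_eq_iff[OF v] F[OF that] by blast
    then show ?thesis
      unfolding E image_iff by auto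
  qed
  \<comment> \<open>Sort the contributing lists by the edge they complete. The classes are disjoint
    because \<open>insert i (set js)\<close> recovers \<open>B\<close>.\<close>
  have U: "{js \<in> ?L. insert i (set js) \<in> F} = (\<Union>B\<in>?Fi. ?P B)"
  proof (intro set_eqI iffI)
    fix js assume "js \<in> {js \<in> ?L. insert i (set js) \<in> F}"
    then have "length js = k - 1" "insert i (set js) \<in> ?Fi"
      by (auto simp: index_lists_def)
    then show "js \<in> (\<Union>B\<in>?Fi. ?P B)" using P by blast
  next
    fix js assume "js \<in> (\<Union>B\<in>?Fi. ?P B)"
    then obtain B where "B \<in> ?Fi" "js \<in> ?P B" by blast
    then have "B \<in> F" "length js = k - 1" "insert i (set js) = B" using P by auto
    then show "js \<in> {js \<in> ?L. insert i (set js) \<in> F}"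
      using F[of B] by (auto simp: index_lists_def)
  qed
  have "(\<Sum>js\<in>?L. adjacency_tensor k v G (i # js) * (\<Prod>j\<leftarrow>js. x j))
      = (\<Sum>js\<in>{js \<in> ?L. insert i (set js) \<in> F}. 1 / fact (k - 1) * (\<Prod>j\<leftarrow>js. x j))"
    unfolding sum.inter_filter[OF finL]
    by (rule sum.cong) (use edge in \<open>auto simp: adjacency_tensor_def\<close>)
  also have "\<dots> = (\<Sum>B\<in>?Fi. \<Sum>js\<in>?P B. 1 / fact (k - 1) * (\<Prod>j\<leftarrow>js. x j))"
    unfolding U
  proof (rule sum.UNION_disjoint)
    show "\<forall>B\<in>?Fi. \<forall>B'\<in>?Fi. B \<noteq> B' \<longrightarrow> ?P B \<inter> ?P B' = {}"
      using P by blast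
  qed (use finF in auto)
  also have "\<dots> = (\<Sum>B\<in>?Fi. \<Prod>j\<in>B - {i}. x j)"
  proof (rule sum.cong[OF refl])
    fix B assume B: "B \<in> ?Fi"
    have "(\<Prod>j\<leftarrow>js. x j) = (\<Prod>j\<in>B - {i}. x j)" if "js \<in> ?P B" for js
      using permutations_of_setD[OF that] by (metis prod.distinct_set_conv_list)
    moreover have "card (?P B) = fact (k - 1)"
      using B F[of B] finB[of B] by simp
    ultimately show "(\<Sum>js\<in>?P B. 1 / fact (k - 1) * (\<Prod>j\<leftarrow>js. x j)) = (\<Prod>j\<in>B - {i}. x j)"
      by simp
  qed
  finally show ?thesis .
qed

text \<open>A core vertex lies in every edge, so its equation is \<open>core\<close> multiplied by
  a^(k-2). A leaf lies in one edge, whose other k-1 vertices are the whole core, so its equation is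
  \<open>leaf\<close>.\<close>

lemma hyperflower_eigenvalueI:
  fixes a \<mu> :: complex and y :: "nat \<Rightarrow> complex"
  assumes G: "hyperflower k N v G"
    and a: "a \<noteq> 0"
    and core: "(\<Sum>j\<in>{k..N}. y j) = \<mu> * a"
    and leaf: "\<And>j. j \<in> {k..N} \<Longrightarrow> a ^ (k - 1) = \<mu> * y j ^ (k - 1)"
  shows "tensor_eigenvalue k N (adjacency_tensor k v G) \<mu>"
proof -
  have k: "2 \<le> k" "k \<le> N" and v: "inj_on v {1..N}"
    and EG: "edges G = (\<lambda>j. v ` {1..k-1} \<union> {v j}) ` {k..N}"
    using G by (auto simp: hyperflower_def)
  let ?C = "{1..k-1}"
  let ?F = "(\<lambda>j. insert j ?C) ` {k..N}"
  define x where "x j = (if j \<in> ?C then a else y j)" for j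
  have E: "edges G = (image v) ` ?F"
    unfolding EG image_image by (rule image_cong) auto
  have F: "B \<subseteq> {1..N} \<and> card B = k" if "B \<in> ?F" for B
    using that k by (auto simp: card_insert_if)
  \<comment> \<open>Distinct leaves give distinct edges, so a sum over edges can be rewritten as a
    sum over leaves.\<close>
  have inj: "inj_on (\<lambda>j. insert j ?C) {k..N}"
  proof (rule inj_onI)
    fix i j assume ij: "i \<in> {k..N}" "j \<in> {k..N}" and eq: "insert i ?C = insert j ?C"
    have "i \<notin> ?C" using ij k by auto
    then show "i = j" using eq by blast
  qed
  have "(\<Sum>js\<in>index_lists (k - 1) N. adjacency_tensor k v G (i # js) * (\<Prod>j\<leftarrow>js. x j))
      = \<mu> * x i ^ (k - 1)" if i: "i \<in> {1..N}" for i
  proof -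
    have *: "(\<Sum>js\<in>index_lists (k - 1) N. adjacency_tensor k v G (i # js) * (\<Prod>j\<leftarrow>js. x j))
        = (\<Sum>B\<in>{B\<in>?F. i \<in> B}. \<Prod>j\<in>B - {i}. x j)"
      by (rule adjacency_tensor_apply[OF v _ E F i]) (use k in auto)
    show ?thesis
    proof (cases "i \<in> ?C")
      case True
      then have "{B\<in>?F. i \<in> B} = ?F" by auto
      then have "(\<Sum>B\<in>{B\<in>?F. i \<in> B}. \<Prod>j\<in>B - {i}. x j)
          = (\<Sum>j\<in>{k..N}. \<Prod>l\<in>insert j ?C - {i}. x l)"
        using sum.reindex[OF inj] by simp
      also have "\<dots> = (\<Sum>j\<in>{k..N}. y j * a ^ (k - 2))"
      proof (rule sum.cong[OF refl])
        fix j assume j: "j \<in> {k..N}"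
        then have "insert j ?C - {i} = insert j (?C - {i})" "j \<notin> ?C - {i}"
          using True by auto
        then have "(\<Prod>l\<in>insert j ?C - {i}. x l) = x j * (\<Prod>l\<in>?C - {i}. x l)" by simp
        also have "(\<Prod>l\<in>?C - {i}. x l) = (\<Prod>l\<in>?C - {i}. a)"
          by (rule prod.cong) (auto simp: x_def)
        \<comment> \<open>Removing \<open>i\<close> from the k-1 core vertices leaves k-2 factors
          \<open>a\<close>.\<close>
        also have "\<dots> = a ^ (k - 2)"
          using True by (simp add: numeral_2_eq_2)
        finally show "(\<Prod>l\<in>insert j ?C - {i}. x l) = y j * a ^ (k - 2)"
          using j k by (auto simp: x_def)
      qed
      also have "\<dots> = \<mu> * (a * a ^ (k - 2))"
        using core by (simp flip: sum_distrib_right)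
      also have "a * a ^ (k - 2) = a ^ (k - 1)"
        using k by (metis Suc_1 Suc_diff_le diff_Suc_Suc power_Suc)
      finally show ?thesis using * True by (simp add: x_def)
    next
      case False
      then have i': "i \<in> {k..N}" using i by auto
      then have "{B\<in>?F. i \<in> B} = {insert i ?C}" using False by auto
      moreover have "insert i ?C - {i} = ?C" using False by auto
      ultimately have "(\<Sum>B\<in>{B\<in>?F. i \<in> B}. \<Prod>j\<in>B - {i}. x j) = (\<Prod>j\<in>?C. x j)"
        by simp
      also have "\<dots> = a ^ (k - 1)" by (simp add: x_def)
      also have "\<dots> = \<mu> * x i ^ (k - 1)"
        unfolding x_def using False leaf[OF i'] by (simp only: if_False)
      finally show ?thesis using * by simp
    qed
  qed
  moreover have "\<exists>i\<in>{1..N}. x i \<noteq> 0"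
    \<comment> \<open>Since k is at least 2, index 1 belongs to the core, where \<open>x\<close>
      takes the nonzero value \<open>a\<close>.\<close>
    by (rule bexI[of _ 1]) (use k a in \<open>auto simp: x_def\<close>)
  ultimately show ?thesis unfolding tensor_eigenvalue_def by blast
qed

theorem theorem5p3:
  fixes G :: "'v hypergraph" and v :: "nat \<Rightarrow> 'v" and k N M :: nat and \<omega> :: complex
  assumes "hyperflower k N v G"
    and "M = card (edges G)"
    and "\<omega> ^ k = 1"
  shows "(\<forall>i<k. tensor_eigenvalue k N (adjacency_tensor k v G)
                  (\<omega> ^ i * complex_of_real (root k (real (M ^ (k - 1)))))) \<and>
         (k \<ge> 3 \<longrightarrow> (\<exists>n>0. M = n * (k - 1) + 1) \<longrightarrow>
            (\<forall>i<k. tensor_eigenvalue k N (adjacency_tensor k v G) (\<omega> ^ i)))"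
proof (intro conjI allI impI)
  have k: "2 \<le> k" "k \<le> N" using assms(1) by (auto simp: hyperflower_def)
  have M: "M = N - k + 1" using card_edges_hyperflower assms(1,2) by simp
  have \<omega>: "(\<omega> ^ i) ^ k = 1" for i
    using assms(3) by (metis power_mult mult.commute power_one)
  fix i
  {
    define \<mu> where "\<mu> = \<omega> ^ i * complex_of_real (root k (real (M ^ (k - 1))))"
    have "root k (real (M ^ (k - 1))) ^ k = real (M ^ (k - 1))"
      using k by (intro real_root_pow_pos2) auto
    then have pow: "\<mu> ^ k = of_nat M ^ (k - 1)"
      unfolding \<mu>_def power_mult_distrib \<omega> of_real_power[symmetric] by simp
    have M0: "(of_nat M :: complex) \<noteq> 0" using M by (simp only: of_nat_eq_0_iff)
    then have "\<mu> ^ k \<noteq> 0" unfolding pow by simp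
    then have \<mu>: "\<mu> \<noteq> 0" using k by (auto simp: power_0_left)
    show "tensor_eigenvalue k N (adjacency_tensor k v G)
        (\<omega> ^ i * complex_of_real (root k (real (M ^ (k - 1)))))"
      unfolding \<mu>_def[symmetric]
    \<comment> \<open>The M leaf values 1 sum to M, so the core equation forces this
      \<open>a\<close>. The leaf equation then amounts to \<open>pow\<close>.\<close>
    proof (rule hyperflower_eigenvalueI[OF assms(1), where a = "of_nat M / \<mu>" and y = "\<lambda>_. 1"])
      show "of_nat M / \<mu> \<noteq> 0" using \<mu> M0 by simp
      show "(\<Sum>j\<in>{k..N}. 1) = \<mu> * (of_nat M / \<mu>)" using \<mu> M k by (simp add: Suc_diff_le)
      have "\<mu> ^ k = \<mu> * \<mu> ^ (k - 1)" using k by (simp add: power_eq_if)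
      then show "(of_nat M / \<mu>) ^ (k - 1) = \<mu> * 1 ^ (k - 1)"
        using pow \<mu> by (simp add: power_divide divide_simps)
    qed
  next
    assume k3: "3 \<le> k" and "\<exists>n>0. M = n * (k - 1) + 1"
    then obtain n where n: "M = n * (k - 1) + 1" by blast
    \<comment> \<open>There are k-1 such roots of unity, hence at least two; k at least 3 is needed
      exactly here, to find one other than 1.\<close>
    have "card {z::complex. z ^ (k - 1) = 1} = k - 1"
      using k3 by (intro card_roots_unity_eq) simp
    then have "\<not> {z::complex. z ^ (k - 1) = 1} \<subseteq> {1}"
      using card_mono[of "{1::complex}" "{z. z ^ (k - 1) = 1}"] k3 by (auto simp del: One_nat_def)
    then obtain \<zeta> :: complex where \<zeta>: "\<zeta> ^ (k - 1) = 1" and \<zeta>1: "\<zeta> \<noteq> 1"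
      by auto
    have \<omega>0: "\<omega> ^ i \<noteq> 0" using assms(3) k by (auto simp: power_0_left)
    show "tensor_eigenvalue k N (adjacency_tensor k v G) (\<omega> ^ i)"
    proof (rule hyperflower_eigenvalueI[OF assms(1), where a = "1 / \<omega> ^ i" and y = "\<lambda>j. \<zeta> ^ (j - k)"])
      show "1 / \<omega> ^ i \<noteq> 0" using \<omega>0 by simp
      have "(\<Sum>j\<in>{k..N}. \<zeta> ^ (j - k)) = (\<Sum>m<M. \<zeta> ^ m)"
        \<comment> \<open>Leaves are numbered from k, so the shift by k makes the exponents run over
          0, ..., M-1.\<close>
        by (rule sum.reindex_bij_witness[of _ "\<lambda>m. m + k" "\<lambda>j. j - k"]) (use M k in auto)
      also have "\<dots> = (\<zeta> ^ M - 1) / (\<zeta> - 1)" by (rule geometric_sum[OF \<zeta>1])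
      \<comment> \<open>M is congruent to 1 modulo k-1, so the geometric quotient collapses to
        1.\<close>
      also have "\<zeta> ^ M = \<zeta>"
        unfolding n power_add mult.commute[of n] power_mult \<zeta> by simp
      finally show "(\<Sum>j\<in>{k..N}. \<zeta> ^ (j - k)) = \<omega> ^ i * (1 / \<omega> ^ i)"
        using \<zeta>1 \<omega>0 by simp
      fix j
      \<comment> \<open>The leaf equation sees only the (k-1)-th power of a leaf value, which is 1
        on every leaf; what remains is (\<omega>^i)^k = 1.\<close>
      have "(\<zeta> ^ (j - k)) ^ (k - 1) = 1"
        using \<zeta> by (metis mult.commute power_mult power_one)
      moreover have "\<omega> ^ i * (\<omega> ^ i) ^ (k - 1) = 1"
        using \<omega>[of i] k by (simp add: power_eq_if)
      ultimately show "(1 / \<omega> ^ i) ^ (k - 1) = \<omega> ^ i * (\<zeta> ^ (j - k)) ^ (k - 1)"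
        using \<omega>0 by (simp add: power_divide divide_simps)
    qed
  }
qed

end
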